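(* Let $x,y,z>0$ be real numbers with $xyz=1$. Then $$\frac{x-1}{x^2-x+1}+\frac{y-1}{y^2-y+1}+\frac{z-1}{z^2-z+1}\le 0.$$ *)

theory Defs
  imports Complex_Main
begin

end

theory Submission
  imports Defs
begin

text \<open>
  The idea is to bound each summand by a function whose sum over three numbers of product 1 is
  controlled by the inequality of Vasc
  \[ \frac1{a^2+a+1}+\frac1{b^2+b+1}+\frac1{c^2+c+1}\ge 1 \quad (a,b,c>0,\ abc=1). \]
  Adding 1 to a summand gives $x^2/(x^2-x+1)$, and since
  $(x^2-x+1)(x^2+x+1)=x^4+x^2+1$, this equals $x^2(x^2+x+1)/(x^4+x^2+1)$. The only term of odd
  degree in $x^2+x+1$ is removed by $x\le (x^2+1)/2$; what remains is a function of $a=x^2$ alone: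
  \[ \frac{x-1}{x^2-x+1}\le \frac12-\frac32\cdot\frac1{a^2+a+1}. \]
  The squares of $x,y,z$ again have product 1, so summing the three bounds gives at most
  $\frac32-\frac32=0$ (\<open>summand_le\<close> and \<open>Vasc_inequality\<close>).
\<close>

lemma quadratic_pos: "a\<^sup>2 + a + 1 > 0" for a :: real
proof -
  have "a\<^sup>2 + a + 1 = (a + 1/2)\<^sup>2 + 3/4"
    by (simp add: power2_eq_square algebra_simps)
  then show ?thesis
    by (smt (verit) zero_le_power2 divide_pos_pos)
qed

text \<open>
  Clear denominators and replace $abc$ by 1 in every monomial that it divides: what remains of
  the inequality is $a^2+b^2+c^2\ge ab+bc+ca$.
\<close>

lemma Vasc_inequality:
  fixes a b c :: real
  assumes "a * b * c = 1"
  shows "1 / (a\<^sup>2 + a + 1) + 1 / (b\<^sup>2 + b + 1) + 1 / (c\<^sup>2 + c + 1) \<ge> 1"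
proof -
  define A B C where ABC: "A = a\<^sup>2 + a + 1" "B = b\<^sup>2 + b + 1" "C = c\<^sup>2 + c + 1"
  have pos: "A > 0" "B > 0" "C > 0"
    unfolding ABC by (rule quadratic_pos)+
  \<comment> \<open>The last summand is the error made by replacing $abc$ by 1; it has the factor $1-abc$.\<close>
  have "B * C + A * C + A * B - A * B * C
      = ((a - b)\<^sup>2 + (b - c)\<^sup>2 + (c - a)\<^sup>2) / 2
        + (1 - a * b * c) * (a + b + c + a * b + b * c + c * a + 2 + a * b * c)"
    unfolding ABC by (simp add: field_simps power2_eq_square)
  then have "B * C + A * C + A * B - A * B * C = ((a - b)\<^sup>2 + (b - c)\<^sup>2 + (c - a)\<^sup>2) / 2"
    using assms by simp
  moreover have "((a - b)\<^sup>2 + (b - c)\<^sup>2 + (c - a)\<^sup>2) / 2 \<ge> 0"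
    by simp
  ultimately have "A * B * C \<le> B * C + A * C + A * B"
    by linarith
  moreover have "1 / A + 1 / B + 1 / C = (B * C + A * C + A * B) / (A * B * C)"
    using pos by (simp add: field_simps)
  ultimately have "1 / A + 1 / B + 1 / C \<ge> 1"
    using pos by simp
  then show ?thesis
    unfolding ABC .
qed

text \<open>
  Among the bounds $\alpha-\beta/(x^4+x^2+1)$, the constants $\alpha=\frac12$ and $\beta=\frac32$
  are the only ones for which the two sides agree to first order at $x=1$, the point of equality.
  The right side then exceeds the left by $\frac{x^2(x-1)^2}{2(x^4+x^2+1)}$.
\<close>

lemma summand_le:
  fixes x :: real
  shows "(x - 1) / (x\<^sup>2 - x + 1) \<le> 1/2 - 3/2 * (1 / ((x\<^sup>2)\<^sup>2 + x\<^sup>2 + 1))"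
proof -
  define P Q where PQ: "P = x\<^sup>2 - x + 1" "Q = x\<^sup>2 + x + 1"
  have pos: "P > 0" "Q > 0"
    using quadratic_pos[of "- x"] quadratic_pos[of x] unfolding PQ by simp_all
  have fac: "(x\<^sup>2)\<^sup>2 + x\<^sup>2 + 1 = P * Q"
    unfolding PQ by (simp add: power2_eq_square algebra_simps)
  have "1/2 - 3/2 * (1 / (P * Q)) - (x - 1) / P = (P * Q - 3 - 2 * (x - 1) * Q) / (2 * (P * Q))"
    using pos by (simp add: field_simps)
  also have "P * Q - 3 - 2 * (x - 1) * Q = (x * (x - 1))\<^sup>2"
    unfolding PQ by (simp add: power2_eq_square algebra_simps)
  also have "(x * (x - 1))\<^sup>2 / (2 * (P * Q)) \<ge> 0"
    using pos by simp
  finally show ?thesis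
    unfolding fac PQ(1)[symmetric] by simp
qed

theorem theorem1:
  fixes x y z :: real
  assumes "x > 0" and "y > 0" and "z > 0"
    and "x * y * z = 1"
  shows "(x - 1) / (x^2 - x + 1) + (y - 1) / (y^2 - y + 1) + (z - 1) / (z^2 - z + 1) \<le> 0"
proof -
  have "x\<^sup>2 * y\<^sup>2 * z\<^sup>2 = 1"
    using assms(4) by (metis power_mult_distrib power_one)
  from Vasc_inequality[OF this] show ?thesis
    using summand_le[of x] summand_le[of y] summand_le[of z] by linarith
qed

end
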